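(* Let $\underline{\hat n}_1,\underline{\hat n}_2\in\mathbb{R}^3$ be two orthogonal unit vectors, ${\bf u}=(u^0,u^1,u^2)\in\mathbb{S}^2$, and $\underline{u}=u^1\underline{\hat n}_1+u^2\underline{\hat n}_2$. For each sign $\pm$ let $\mathcal{A}^\pm_{\bf u}$ be the $*$-algebra generated by hermitian elements $x_1^\mu,x_2^\alpha$, $\mu,\alpha\in\{0,1,2,3\}$, with relations $$x_1^\lambda x_1^\mu=x_1^\mu x_1^\lambda,\quad x_2^\alpha x_2^\beta=x_2^\beta x_2^\alpha,\quad x_1^\lambda x_2^\alpha=u^0\,x_2^\alpha x_1^\lambda+\mathrm{i}\,(J^\pm_{\underline{u}})^\alpha_\beta x_2^\beta\,(J^\pm_{\underline{\hat n}_1})^\lambda_\rho x_1^\rho.$$ Then the relations of $\mathcal{A}^+_{\bf u}$ are invariant under the $\mathrm{SU}(2)\times\mathrm{SU}(2)$ action $$x_1^\lambda\mapsto(J^-_{q_1})^\lambda_\nu x_1^\nu,\qquad x_2^\alpha\mapsto(J^-_{q_2})^\alpha_\beta x_2^\beta,\qquad q_1,q_2\in\mathbb{H}_1,$$ and the relations of $\mathcal{A}^-_{\bf u}$ are invariant under the $\mathrm{SU}(2)\times\mathrm{SU}(2)$ action $$x_1^\lambda\mapsto(J^+_{q_1})^\lambda_\nu x_1^\nu,\qquad x_2^\alpha\mapsto(J^+_{q_2})^\alpha_\beta x_2^\beta,\qquad q_1,q_2\in\mathbb{H}_1;$$ that is, in each case the transformed elements satisfy the same relations as the original generators.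
   Context: Repeated up-down indices are summed over $\{0,1,2,3\}$. $\mathbb{H}_1\simeq\mathrm{SU}(2)$ is the group of unit quaternions. Identify the quaternions $\mathbb{H}$ with $\mathbb{R}^4$ by $q=x^0+x^1e_1+x^2e_2+x^3e_3\mapsto(x^0,x^1,x^2,x^3)$, where $e_ae_b=-\delta_{ab}+\sum_c\varepsilon_{abc}e_c$. For $a=1,2,3$, $J^+_a$ is the real $4\times4$ matrix of left multiplication $q\mapsto e_aq$ and $J^-_a$ is minus the matrix of right multiplication $q\mapsto qe_a$. For $\underline{w}=(w^1,w^2,w^3)\in\mathbb{R}^3$ put $J^\pm_{\underline{w}}=\sum_aw^aJ^\pm_a$, and for a quaternion $q=q^0+q^1e_1+q^2e_2+q^3e_3$ put $J^\pm_q=q^01+\sum_aq^aJ^\pm_a$. *)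

theory Defs
  imports "HOL-Analysis.Analysis" "HOL-Library.Poly_Mapping" "HOL-Algebra.QuotRing" "HOL-Algebra.Module"
begin

text \<open>
  A quaternion is a vector of type \<open>real ^ 4\<close>. The index type \<open>4\<close> consists of the residues
  \<open>0, 1, 2, 3\<close> modulo 4, so component \<open>0\<close> is the real part. In the same way a vector in \<open>real ^ 3\<close>
  has the components \<open>1, 2, 3\<close>, which can also be read as \<open>0, 1, 2\<close> because \<open>3 = 0\<close> in type \<open>3\<close>.
\<close>

type_synonym quat = "real ^ 4"

definition quat :: "real \<Rightarrow> real ^ 3 \<Rightarrow> quat" where
  "quat r v = (\<chi> \<mu>. if \<mu> = 0 then r else if \<mu> = 1 then v $ 1 else if \<mu> = 2 then v $ 2 else v $ 3)"

definition qim :: "quat \<Rightarrow> real ^ 3" where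
  "qim q = vector [q $ 1, q $ 2, q $ 3]"

text \<open>
  The product is the real bilinear one determined by
  \<open>e\<^sub>a e\<^sub>b = - \<delta>\<^sub>a\<^sub>b + (\<Sum>c. \<epsilon>\<^sub>a\<^sub>b\<^sub>c e\<^sub>c)\<close> and \<open>1\<close> being the unit: \<open>\<delta>\<close> gives the inner product
  of the imaginary parts and \<open>\<epsilon>\<close> their cross product.
\<close>

definition qmult :: "quat \<Rightarrow> quat \<Rightarrow> quat" where
  "qmult p q = quat (p $ 0 * q $ 0 - qim p \<bullet> qim q)
                    (p $ 0 *\<^sub>R qim q + q $ 0 *\<^sub>R qim p + cross3 (qim p) (qim q))"

definition qunit :: "3 \<Rightarrow> quat" where
  "qunit a = quat 0 (axis a 1)"

definition unit_quats :: "quat set" where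
  "unit_quats = {q. norm q = 1}"

datatype sign = Plus | Minus

fun J :: "sign \<Rightarrow> 3 \<Rightarrow> real ^ 4 ^ 4" where
  "J Plus a = matrix (\<lambda>q. qmult (qunit a) q)"
| "J Minus a = - matrix (\<lambda>q. qmult q (qunit a))"

definition J_vec :: "sign \<Rightarrow> real ^ 3 \<Rightarrow> real ^ 4 ^ 4" where
  "J_vec s w = (\<Sum>a\<in>UNIV. w $ a *\<^sub>R J s a)"

definition J_quat :: "sign \<Rightarrow> quat \<Rightarrow> real ^ 4 ^ 4" where
  "J_quat s q = q $ 0 *\<^sub>R mat 1 + (\<Sum>a\<in>UNIV. qim q $ a *\<^sub>R J s a)"

lemma UNIV_4_from_0: "(UNIV :: 4 set) = {0, 1, 2, 3}"
proof -
  have *: "(4 :: 4) = 0" by simp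
  show ?thesis unfolding UNIV_4 * by blast
qed

lemma all_4_from_0: "(\<forall>i::4. P i) \<longleftrightarrow> P 0 \<and> P 1 \<and> P 2 \<and> P 3" (is "_ \<longleftrightarrow> ?R")
proof
  assume ?R
  then have "\<forall>i\<in>{0, 1, 2, 3 :: 4}. P i" by blast
  then show "\<forall>i. P i" unfolding UNIV_4_from_0[symmetric] by blast
qed blast

lemma sum_4_from_0: "sum f (UNIV :: 4 set) = f 0 + f 1 + f 2 + f 3"
  unfolding UNIV_4_from_0 by (simp add: add.assoc)

text \<open>
  Both \<open>J_quat Plus\<close> and \<open>J_quat Minus\<close> are multiplicative, so each of them is an action of the
  unit quaternions on \<open>real ^ 4\<close>.
\<close>

lemma J_quat_qmult: "J_quat s (qmult p q) = J_quat s p ** J_quat s q"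
proof (cases s)
  case Plus
  show ?thesis unfolding Plus
    by (simp add: quat_def qim_def qmult_def qunit_def cross3_def inner_vec_def sum_3
        sum_4_from_0 vec_eq_iff all_4_from_0 forall_3 axis_def matrix_def matrix_matrix_mult_def
        mat_def J_quat_def algebra_simps)
next
  case Minus
  show ?thesis unfolding Minus
    by (simp add: quat_def qim_def qmult_def qunit_def cross3_def inner_vec_def sum_3
        sum_4_from_0 vec_eq_iff all_4_from_0 forall_3 axis_def matrix_def matrix_matrix_mult_def
        mat_def J_quat_def algebra_simps)
qed

lemma J_quat_one: "J_quat s (quat 1 0) = mat 1"
  by (simp add: J_quat_def quat_def qim_def sum_3)

text \<open>Only the signature of a complex unital *-algebra; the record carries no axioms.\<close>

record 'a star_algebra = "(complex, 'a) module" +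
  star :: "'a \<Rightarrow> 'a"

text \<open>
  The free *-algebra on hermitian generators indexed by \<open>'g\<close>: finitely supported complex functions
  on the free monoid of words, with convolution as product. The involution reverses words and
  conjugates coefficients, so each one-letter word is hermitian.
\<close>

datatype 'g word = Word (letters: "'g list")

instantiation word :: (type) monoid_add
begin

definition zero_word :: "'a word" where
  "0 = Word []"

definition plus_word :: "'a word \<Rightarrow> 'a word \<Rightarrow> 'a word" where
  "v + w = Word (letters v @ letters w)"

instance
  by standard (simp_all add: zero_word_def plus_word_def)

end

definition free_star_algebra :: "('g word \<Rightarrow>\<^sub>0 complex) star_algebra" where
  "free_star_algebra =
     \<lparr>carrier = UNIV, monoid.mult = (*), one = 1, zero = 0, add = (+),
      smult = (\<lambda>c p. Poly_Mapping.single 0 c * p),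
      star = (\<lambda>p. \<Sum>w\<in>Poly_Mapping.keys p.
                Poly_Mapping.single (Word (rev (letters w))) (cnj (Poly_Mapping.lookup p w)))\<rparr>"

definition gen :: "'g \<Rightarrow> ('g word \<Rightarrow>\<^sub>0 complex)" where
  "gen g = Poly_Mapping.single (Word [g]) 1"

definition star_ideal :: "('a, 'm) star_algebra_scheme \<Rightarrow> 'a set \<Rightarrow> bool" where
  "star_ideal A I \<longleftrightarrow> ideal I A \<and> (\<forall>c. \<forall>x\<in>I. c \<odot>\<^bsub>A\<^esub> x \<in> I) \<and> (\<forall>x\<in>I. star A x \<in> I)"

definition star_ideal_generated :: "('a, 'm) star_algebra_scheme \<Rightarrow> 'a set \<Rightarrow> 'a set" where
  "star_ideal_generated A S = \<Inter>{I. star_ideal A I \<and> S \<subseteq> I}"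

definition star_quotient :: "('a, 'm) star_algebra_scheme \<Rightarrow> 'a set \<Rightarrow> 'a set star_algebra" where
  "star_quotient A I =
     \<lparr>carrier = carrier (A Quot I), monoid.mult = monoid.mult (A Quot I), one = one (A Quot I),
      zero = zero (A Quot I), add = add (A Quot I),
      smult = (\<lambda>c X. \<Union>x\<in>X. I +>\<^bsub>A\<^esub> (c \<odot>\<^bsub>A\<^esub> x)),
      star = (\<lambda>X. \<Union>x\<in>X. I +>\<^bsub>A\<^esub> star A x)\<rparr>"

text \<open>\<open>M\<^sup>\<lambda>\<^sub>\<rho> x\<^sup>\<rho>\<close> with summation over \<open>\<rho>\<close>.\<close>

definition mat_act :: "('a, 'm) star_algebra_scheme \<Rightarrow> real ^ 4 ^ 4 \<Rightarrow> (4 \<Rightarrow> 'a) \<Rightarrow> 4 \<Rightarrow> 'a" where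
  "mat_act A M x = (\<lambda>i. \<Oplus>\<^bsub>A\<^esub>j\<in>UNIV. complex_of_real (M $ i $ j) \<odot>\<^bsub>A\<^esub> x j)"

text \<open>
  The relations, as pairs of a left and a right hand side, for elements \<open>x1\<close>, \<open>x2\<close> of any
  *-algebra. The vector \<open>u\<close> has the components \<open>u $ 0\<close>, \<open>u $ 1\<close>, \<open>u $ 2\<close>. In the last family
  the two matrices act on different factors, so the double sum is the product of the two sums.
\<close>

definition relations ::
  "('a, 'm) star_algebra_scheme \<Rightarrow> sign \<Rightarrow> real ^ 3 \<Rightarrow> real ^ 3 \<Rightarrow> real ^ 3 \<Rightarrow>
   (4 \<Rightarrow> 'a) \<Rightarrow> (4 \<Rightarrow> 'a) \<Rightarrow> ('a \<times> 'a) set" where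
  "relations A s n1 n2 u x1 x2 =
     {(star A (x1 \<mu>), x1 \<mu>) | \<mu>. True} \<union>
     {(star A (x2 \<alpha>), x2 \<alpha>) | \<alpha>. True} \<union>
     {(x1 l \<otimes>\<^bsub>A\<^esub> x1 \<mu>, x1 \<mu> \<otimes>\<^bsub>A\<^esub> x1 l) | l \<mu>. True} \<union>
     {(x2 \<alpha> \<otimes>\<^bsub>A\<^esub> x2 \<beta>, x2 \<beta> \<otimes>\<^bsub>A\<^esub> x2 \<alpha>) | \<alpha> \<beta>. True} \<union>
     {(x1 l \<otimes>\<^bsub>A\<^esub> x2 \<alpha>,
       complex_of_real (u $ 0) \<odot>\<^bsub>A\<^esub> (x2 \<alpha> \<otimes>\<^bsub>A\<^esub> x1 l) \<oplus>\<^bsub>A\<^esub>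
       \<i> \<odot>\<^bsub>A\<^esub> (mat_act A (J_vec s (u $ 1 *\<^sub>R n1 + u $ 2 *\<^sub>R n2)) x2 \<alpha> \<otimes>\<^bsub>A\<^esub>
               mat_act A (J_vec s n1) x1 l)) | l \<alpha>. True}"

definition satisfies_relations ::
  "('a, 'm) star_algebra_scheme \<Rightarrow> sign \<Rightarrow> real ^ 3 \<Rightarrow> real ^ 3 \<Rightarrow> real ^ 3 \<Rightarrow>
   (4 \<Rightarrow> 'a) \<Rightarrow> (4 \<Rightarrow> 'a) \<Rightarrow> bool" where
  "satisfies_relations A s n1 n2 u x1 x2 \<longleftrightarrow>
     range x1 \<subseteq> carrier A \<and> range x2 \<subseteq> carrier A \<and>
     (\<forall>(l, r) \<in> relations A s n1 n2 u x1 x2. l = r)"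

datatype generator = X1 4 | X2 4

definition relation_ideal ::
  "sign \<Rightarrow> real ^ 3 \<Rightarrow> real ^ 3 \<Rightarrow> real ^ 3 \<Rightarrow> (generator word \<Rightarrow>\<^sub>0 complex) set" where
  "relation_ideal s n1 n2 u =
     star_ideal_generated free_star_algebra
       {l - r | l r. (l, r) \<in> relations free_star_algebra s n1 n2 u (gen \<circ> X1) (gen \<circ> X2)}"

definition algebra_A ::
  "sign \<Rightarrow> real ^ 3 \<Rightarrow> real ^ 3 \<Rightarrow> real ^ 3 \<Rightarrow> (generator word \<Rightarrow>\<^sub>0 complex) set star_algebra" where
  "algebra_A s n1 n2 u = star_quotient free_star_algebra (relation_ideal s n1 n2 u)"

definition gen1 ::
  "sign \<Rightarrow> real ^ 3 \<Rightarrow> real ^ 3 \<Rightarrow> real ^ 3 \<Rightarrow> 4 \<Rightarrow> (generator word \<Rightarrow>\<^sub>0 complex) set" where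
  "gen1 s n1 n2 u \<mu> = relation_ideal s n1 n2 u +>\<^bsub>free_star_algebra\<^esub> gen (X1 \<mu>)"

definition gen2 ::
  "sign \<Rightarrow> real ^ 3 \<Rightarrow> real ^ 3 \<Rightarrow> real ^ 3 \<Rightarrow> 4 \<Rightarrow> (generator word \<Rightarrow>\<^sub>0 complex) set" where
  "gen2 s n1 n2 u \<alpha> = relation_ideal s n1 n2 u +>\<^bsub>free_star_algebra\<^esub> gen (X2 \<alpha>)"

end

theory Submission
  imports Defs
begin

text \<open>
  Left and right multiplications by quaternions commute, so for opposite signs every \<open>J_vec s w\<close>
  commutes with every \<open>J_quat t q\<close> (\<open>J_vec_commute_J_quat\<close>). This alone makes the relations
  invariant. Let \<open>M\<close> and \<open>N\<close> be real matrices that commute with all \<open>J_vec s w\<close>, and put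
  \<open>x\<^sub>1' = M x\<^sub>1\<close> and \<open>x\<^sub>2' = N x\<^sub>2\<close>. Then the difference of the two sides of the mixed relation for
  \<open>x\<^sub>1', x\<^sub>2'\<close> at the indices \<open>\<lambda>, \<alpha>\<close> is the sum over \<open>\<rho>, \<beta>\<close> of
  \<open>M\<^sup>\<lambda>\<^sub>\<rho> N\<^sup>\<alpha>\<^sub>\<beta>\<close> times the same difference for \<open>x\<^sub>1, x\<^sub>2\<close> at \<open>\<rho>, \<beta>\<close>: the matrices \<open>M\<close> and \<open>N\<close> can
  be pulled out past the \<open>J\<close>'s. The same holds for the two commutation relations, and for the
  hermiticity relations because the entries of \<open>M\<close> and \<open>N\<close> are real.

  The computation takes place in the free *-algebra, where it says that any *-ideal that contains
  the differences for \<open>x\<^sub>1, x\<^sub>2\<close> also contains those for \<open>x\<^sub>1', x\<^sub>2'\<close>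
  (\<open>relations_mat_act_in_ideal\<close>). Since the projection to the quotient by a *-ideal respects all
  operations, relations that hold modulo the ideal hold in the quotient
  (\<open>satisfies_relations_star_quotient\<close>).
\<close>

section \<open>Left and right multiplications commute\<close>

lemma J_vec_commute_J_quat:
  assumes "s \<noteq> t"
  shows "J_vec s w ** J_quat t q = J_quat t q ** J_vec s w"
proof (cases s)
  case Plus
  with assms have t: "t = Minus" by (cases t) auto
  show ?thesis unfolding Plus t
    by (simp add: quat_def qim_def qmult_def qunit_def cross3_def inner_vec_def sum_3
        sum_4_from_0 vec_eq_iff all_4_from_0 forall_3 axis_def matrix_def matrix_matrix_mult_def
        mat_def J_quat_def J_vec_def algebra_simps)
next
  case Minus
  with assms have t: "t = Plus" by (cases t) auto
  show ?thesis unfolding Minus t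
    by (simp add: quat_def qim_def qmult_def qunit_def cross3_def inner_vec_def sum_3
        sum_4_from_0 vec_eq_iff all_4_from_0 forall_3 axis_def matrix_def matrix_matrix_mult_def
        mat_def J_quat_def J_vec_def algebra_simps)
qed

section \<open>The free *-algebra\<close>

text \<open>
  The multiple \<open>c \<cdot> 1\<close> of the unit; \<open>0\<close> is the empty word. Scalar multiplication by \<open>c\<close> is
  multiplication by this central element.
\<close>

abbreviation scalar :: "complex \<Rightarrow> ('g word \<Rightarrow>\<^sub>0 complex)" where
  "scalar c \<equiv> Poly_Mapping.single 0 c"

lemma free_star_algebra_simps [simp]:
  "carrier free_star_algebra = UNIV"
  "x \<otimes>\<^bsub>free_star_algebra\<^esub> y = x * y"
  "\<one>\<^bsub>free_star_algebra\<^esub> = 1"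
  "\<zero>\<^bsub>free_star_algebra\<^esub> = 0"
  "x \<oplus>\<^bsub>free_star_algebra\<^esub> y = x + y"
  "c \<odot>\<^bsub>free_star_algebra\<^esub> x = scalar c * x"
  by (simp_all add: free_star_algebra_def)

lemma ring_free_star_algebra: "ring free_star_algebra"
proof (rule ringI)
  show "abelian_group (free_star_algebra :: ('g word \<Rightarrow>\<^sub>0 complex) star_algebra)"
  proof (rule abelian_groupI)
    fix x :: "'g word \<Rightarrow>\<^sub>0 complex"
    show "\<exists>y\<in>carrier free_star_algebra. y \<oplus>\<^bsub>free_star_algebra\<^esub> x = \<zero>\<^bsub>free_star_algebra\<^esub>"
      by (auto intro: exI[of _ "- x"])
  qed (simp_all add: algebra_simps)
  show "Group.monoid (free_star_algebra :: ('g word \<Rightarrow>\<^sub>0 complex) star_algebra)"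
    by (rule monoidI) (simp_all add: algebra_simps)
qed (simp_all add: algebra_simps)

lemma finsum_free_star_algebra:
  "finite S \<Longrightarrow> finsum free_star_algebra f S = sum f S"
proof (induction rule: finite_induct)
  interpret ring free_star_algebra by (rule ring_free_star_algebra)
  case empty
  show ?case by (simp add: finsum_empty)
next
  interpret ring free_star_algebra by (rule ring_free_star_algebra)
  case (insert a S)
  then show ?case by (simp add: finsum_insert)
qed

lemma mat_act_free_star_algebra:
  "mat_act free_star_algebra M x i = (\<Sum>j\<in>UNIV. scalar (of_real (M $ i $ j)) * x j)"
  by (simp add: mat_act_def finsum_free_star_algebra)

lemma poly_mapping_add_induct [case_names zero single add]:
  assumes "P 0" and "\<And>k v. P (Poly_Mapping.single k v)"
    and "\<And>f g. P f \<Longrightarrow> P g \<Longrightarrow> P (f + g)"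
  shows "P (f :: 'a \<Rightarrow>\<^sub>0 'b::monoid_add)"
proof (induction f rule: update_induct)
  case const
  show ?case by (rule assms)
next
  case (update f a b)
  then have "Poly_Mapping.update a b f = f + Poly_Mapping.single a b"
    by (auto simp: poly_mapping_eq_iff fun_eq_iff lookup_add lookup_single when_def
        in_keys_iff lookup_update)
  with update assms show ?case by simp
qed

lemma scalar_commute: "scalar c * p = p * scalar c"
proof (induction p rule: poly_mapping_add_induct)
  case zero
  show ?case by simp
next
  case (single k v)
  show ?case by (simp add: mult_single mult.commute)
next
  case (add f g)
  then show ?case by (simp add: algebra_simps)
qed

lemma scalar_mult: "scalar c * scalar d = scalar (c * d)"
  by (simp add: mult_single)

lemma scalar_sum: "(\<Sum>i\<in>S. scalar (f i)) = scalar (\<Sum>i\<in>S. f i)"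
  by (induction S rule: infinite_finite_induct) (simp_all add: single_add)

lemma star_free_star_algebra_superset:
  assumes "finite S" "Poly_Mapping.keys p \<subseteq> S"
  shows "star free_star_algebra p =
    (\<Sum>w\<in>S. Poly_Mapping.single (Word (rev (letters w))) (cnj (Poly_Mapping.lookup p w)))"
  unfolding free_star_algebra_def
  by (simp, rule sum.mono_neutral_left) (use assms in \<open>auto simp: in_keys_iff\<close>)

lemma star_free_star_algebra_add:
  "star free_star_algebra (p + q) = star free_star_algebra p + star free_star_algebra q"
proof -
  let ?S = "Poly_Mapping.keys p \<union> Poly_Mapping.keys q"
  have "Poly_Mapping.keys (p + q) \<subseteq> ?S" by (rule keys_add)
  then show ?thesis
    by (simp add: star_free_star_algebra_superset[of ?S] lookup_add single_add sum.distrib)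
qed

lemma star_free_star_algebra_single:
  "star free_star_algebra (Poly_Mapping.single w c) =
    Poly_Mapping.single (Word (rev (letters w))) (cnj c)"
  by (subst star_free_star_algebra_superset[of "{w}"]) simp_all

lemma star_free_star_algebra_smult:
  "star free_star_algebra (scalar c * p) = scalar (cnj c) * star free_star_algebra p"
proof (induction p rule: poly_mapping_add_induct)
  case zero
  show ?case by (simp add: free_star_algebra_def)
next
  case (single k v)
  show ?case by (simp add: mult_single star_free_star_algebra_single)
next
  case (add f g)
  then show ?case by (simp add: distrib_left star_free_star_algebra_add)
qed

lemma star_free_star_algebra_sum:
  "finite S \<Longrightarrow> star free_star_algebra (sum f S) = (\<Sum>i\<in>S. star free_star_algebra (f i))"
proof (induction rule: finite_induct)
  case empty
  show ?case by (simp add: free_star_algebra_def)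
qed (simp add: star_free_star_algebra_add)

lemma mat_act_compose:
  "mat_act free_star_algebra M (mat_act free_star_algebra N x) =
    mat_act free_star_algebra (M ** N) x"
proof
  fix i
  have "mat_act free_star_algebra M (mat_act free_star_algebra N x) i =
      (\<Sum>j\<in>UNIV. \<Sum>k\<in>UNIV. scalar (of_real (M $ i $ j * N $ j $ k)) * x k)"
    by (simp add: mat_act_free_star_algebra sum_distrib_left mult.assoc[symmetric] scalar_mult)
  also have "\<dots> = (\<Sum>k\<in>UNIV. \<Sum>j\<in>UNIV. scalar (of_real (M $ i $ j * N $ j $ k)) * x k)"
    by (rule sum.swap)
  also have "\<dots> = mat_act free_star_algebra (M ** N) x i"
    by (simp add: mat_act_free_star_algebra matrix_matrix_mult_def scalar_sum
        flip: sum_distrib_right)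
  finally show "mat_act free_star_algebra M (mat_act free_star_algebra N x) i =
      mat_act free_star_algebra (M ** N) x i" .
qed

lemma mat_act_mult:
  "mat_act free_star_algebra M x i * mat_act free_star_algebra N y k =
    (\<Sum>j\<in>UNIV. \<Sum>l\<in>UNIV. scalar (of_real (M $ i $ j * N $ k $ l)) * (x j * y l))"
proof -
  have "scalar a * x j * (scalar b * y l) = scalar (a * b) * (x j * y l)" for a b j l
    by (metis mult.assoc scalar_commute scalar_mult)
  then show ?thesis
    by (simp add: mat_act_free_star_algebra sum_product)
qed

text \<open>
  The product in the opposite order, expanded with the coefficients and the order of summation of
  \<open>mat_act_mult\<close>, so that the two expansions can be combined term by term.
\<close>

lemma mat_act_mult_swap:
  "mat_act free_star_algebra N y k * mat_act free_star_algebra M x i =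
    (\<Sum>j\<in>UNIV. \<Sum>l\<in>UNIV. scalar (of_real (M $ i $ j * N $ k $ l)) * (y l * x j))"
  unfolding mat_act_mult by (subst sum.swap) (simp add: mult.commute)

section \<open>Ideals containing the relations\<close>

context
  fixes I :: "('g word \<Rightarrow>\<^sub>0 complex) set"
  assumes star_ideal: "star_ideal free_star_algebra I"
begin

lemma ideal_I: "ideal I free_star_algebra"
  using star_ideal by (simp add: star_ideal_def)

lemma ideal_add: "p \<in> I \<Longrightarrow> q \<in> I \<Longrightarrow> p + q \<in> I"
  using additive_subgroup.a_closed[OF ideal.axioms(1)[OF ideal_I]] by simp

lemma ideal_zero: "0 \<in> I"
  using additive_subgroup.zero_closed[OF ideal.axioms(1)[OF ideal_I]] by simp

lemma ideal_mult_left: "p \<in> I \<Longrightarrow> q * p \<in> I"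
  using ideal.I_l_closed[OF ideal_I] by simp

lemma ideal_sum: "(\<And>j. j \<in> S \<Longrightarrow> f j \<in> I) \<Longrightarrow> sum f S \<in> I"
  by (induction S rule: infinite_finite_induct) (simp_all add: ideal_zero ideal_add)

text \<open>
  Matrices that commute with all \<open>J_vec s w\<close> preserve the relations modulo a *-ideal, since each new
  relation is a linear combination of old ones.
\<close>

lemma relations_mat_act_in_ideal:
  assumes rel: "\<And>l r. (l, r) \<in> relations free_star_algebra s n1 n2 u x1 x2 \<Longrightarrow> l - r \<in> I"
    and M: "\<And>w. J_vec s w ** M = M ** J_vec s w"
    and N: "\<And>w. J_vec s w ** N = N ** J_vec s w"
    and lr: "(l, r) \<in> relations free_star_algebra s n1 n2 u
      (mat_act free_star_algebra M x1) (mat_act free_star_algebra N x2)"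
  shows "l - r \<in> I"
proof -
  let ?F = "free_star_algebra :: ('g word \<Rightarrow>\<^sub>0 complex) star_algebra"
  let ?v = "u $ 1 *\<^sub>R n1 + u $ 2 *\<^sub>R n2"
  have herm: "star ?F (mat_act ?F K x i) - mat_act ?F K x i \<in> I"
    if "\<And>j. star ?F (x j) - x j \<in> I" for K x i
  proof -
    have "star ?F (mat_act ?F K x i) - mat_act ?F K x i =
        (\<Sum>j\<in>UNIV. scalar (of_real (K $ i $ j)) * (star ?F (x j) - x j))"
      by (simp add: mat_act_free_star_algebra star_free_star_algebra_sum
          star_free_star_algebra_smult right_diff_distrib sum_subtractf)
    then show ?thesis
      by (simp add: ideal_sum ideal_mult_left that)
  qed
  have comm: "mat_act ?F K x i * mat_act ?F K x k - mat_act ?F K x k * mat_act ?F K x i \<in> I"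
    if "\<And>j l. x j * x l - x l * x j \<in> I" for K x i k
  proof -
    have "mat_act ?F K x i * mat_act ?F K x k - mat_act ?F K x k * mat_act ?F K x i =
        (\<Sum>j\<in>UNIV. \<Sum>l\<in>UNIV. scalar (of_real (K $ i $ j * K $ k $ l)) * (x j * x l - x l * x j))"
      unfolding mat_act_mult_swap[of K x k K x i] unfolding mat_act_mult
      by (simp add: right_diff_distrib sum_subtractf)
    then show ?thesis
      by (simp add: ideal_sum ideal_mult_left that)
  qed
  have cross: "mat_act ?F M x1 i * mat_act ?F N x2 k -
      (scalar (of_real (u $ 0)) * (mat_act ?F N x2 k * mat_act ?F M x1 i) +
       scalar \<i> * (mat_act ?F (J_vec s ?v) (mat_act ?F N x2) k *
                    mat_act ?F (J_vec s n1) (mat_act ?F M x1) i)) \<in> I" for i k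
  proof -
    let ?y1 = "mat_act ?F (J_vec s n1) x1" and ?y2 = "mat_act ?F (J_vec s ?v) x2"
    have y1: "mat_act ?F (J_vec s n1) (mat_act ?F M x1) = mat_act ?F M ?y1"
      by (simp add: mat_act_compose M)
    have y2: "mat_act ?F (J_vec s ?v) (mat_act ?F N x2) = mat_act ?F N ?y2"
      by (simp add: mat_act_compose N)
    have swap: "scalar c * (scalar d * p) = scalar d * (scalar c * p)"
      for c d and p :: "'g word \<Rightarrow>\<^sub>0 complex"
      by (simp add: mult.assoc[symmetric] scalar_mult mult.commute)
    have "mat_act ?F M x1 i * mat_act ?F N x2 k -
      (scalar (of_real (u $ 0)) * (mat_act ?F N x2 k * mat_act ?F M x1 i) +
       scalar \<i> * (mat_act ?F N ?y2 k * mat_act ?F M ?y1 i)) =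
      (\<Sum>j\<in>UNIV. \<Sum>l\<in>UNIV. scalar (of_real (M $ i $ j * N $ k $ l)) *
         (x1 j * x2 l - (scalar (of_real (u $ 0)) * (x2 l * x1 j) + scalar \<i> * (?y2 l * ?y1 j))))"
      unfolding mat_act_mult_swap[of N _ k M _ i] unfolding mat_act_mult[of M _ i N _ k]
      by (simp only: right_diff_distrib distrib_left sum_subtractf sum.distrib sum_distrib_left
          swap[of "of_real (u $ 0)"] swap[of \<i>])
    moreover have "x1 j * x2 l -
        (scalar (of_real (u $ 0)) * (x2 l * x1 j) + scalar \<i> * (?y2 l * ?y1 j)) \<in> I" for j l
      by (rule rel) (auto simp: relations_def)
    ultimately show ?thesis
      unfolding y1 y2 by (simp add: ideal_sum ideal_mult_left)
  qed
  have "star ?F (x1 j) - x1 j \<in> I" "star ?F (x2 j) - x2 j \<in> I"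
    "x1 j * x1 l - x1 l * x1 j \<in> I" "x2 j * x2 l - x2 l * x2 j \<in> I" for j l
    by (rule rel; force simp: relations_def)+
  then show ?thesis
    using lr unfolding relations_def by (auto intro: herm comm cross)
qed

section \<open>The quotient *-algebra\<close>

text \<open>The canonical projection onto the quotient.\<close>

abbreviation proj :: "('g word \<Rightarrow>\<^sub>0 complex) \<Rightarrow> ('g word \<Rightarrow>\<^sub>0 complex) set" where
  "proj p \<equiv> I +>\<^bsub>free_star_algebra\<^esub> p"

lemma proj_eq: "proj p = {i + p | i. i \<in> I}"
  by (auto simp: a_r_coset_def')

lemma proj_eqI:
  assumes "p - q \<in> I"
  shows "proj p = proj q"
proof -
  interpret ideal I free_star_algebra by (rule ideal_I)
  have "p \<in> proj q" unfolding proj_eq by (force intro: exI[of _ "p - q"] assms)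
  then have "proj q = proj p" by (rule a_repr_independence') simp_all
  then show ?thesis by simp
qed

lemma star_quotient_ops:
  "proj p \<in> carrier (star_quotient free_star_algebra I)"
  "proj p \<otimes>\<^bsub>star_quotient free_star_algebra I\<^esub> proj q = proj (p * q)"
  "proj p \<oplus>\<^bsub>star_quotient free_star_algebra I\<^esub> proj q = proj (p + q)"
proof -
  have h: "(+>\<^bsub>free_star_algebra\<^esub>) I \<in> ring_hom free_star_algebra (free_star_algebra Quot I)"
    by (rule ideal.rcos_ring_hom[OF ideal_I])
  show "proj p \<in> carrier (star_quotient free_star_algebra I)"
    using ring_hom_closed[OF h, of p] by (simp add: star_quotient_def)
  show "proj p \<otimes>\<^bsub>star_quotient free_star_algebra I\<^esub> proj q = proj (p * q)"
    using ring_hom_mult[OF h, of p q] by (simp add: star_quotient_def)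
  show "proj p \<oplus>\<^bsub>star_quotient free_star_algebra I\<^esub> proj q = proj (p + q)"
    using ring_hom_add[OF h, of p q] by (simp add: star_quotient_def)
qed

text \<open>
  The unary operations of \<open>star_quotient\<close> are unions over all representatives of a coset; such a
  union is a single coset as soon as the operation respects the ideal.
\<close>

lemma UN_proj:
  assumes "\<And>i. i \<in> I \<Longrightarrow> f (i + p) - f p \<in> I"
  shows "(\<Union>x\<in>proj p. proj (f x)) = proj (f p)"
proof -
  have "proj (f x) = proj (f p)" if "x \<in> proj p" for x
    using that assms by (intro proj_eqI) (auto simp: proj_eq[of p])
  moreover have "p \<in> proj p"
    unfolding proj_eq using ideal_zero by force
  ultimately show ?thesis by blast
qed

lemma star_quotient_smult:
  "c \<odot>\<^bsub>star_quotient free_star_algebra I\<^esub> proj p = proj (scalar c * p)"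
proof -
  have "(\<Union>x\<in>proj p. proj (scalar c * x)) = proj (scalar c * p)"
    by (rule UN_proj) (simp add: distrib_left ideal_mult_left)
  then show ?thesis by (simp add: star_quotient_def)
qed

lemma star_quotient_star:
  "star (star_quotient free_star_algebra I) (proj p) = proj (star free_star_algebra p)"
proof -
  have "(\<Union>x\<in>proj p. proj (star free_star_algebra x)) = proj (star free_star_algebra p)"
    using star_ideal by (intro UN_proj) (simp add: star_free_star_algebra_add star_ideal_def)
  then show ?thesis by (simp add: star_quotient_def)
qed

lemma star_quotient_finsum:
  assumes "finite S"
  shows "finsum (star_quotient free_star_algebra I) (\<lambda>j. proj (f j)) S = proj (sum f S)"
proof -
  let ?Q = "free_star_algebra Quot I"
  have h: "(+>\<^bsub>free_star_algebra\<^esub>) I \<in> ring_hom free_star_algebra ?Q"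
    by (rule ideal.rcos_ring_hom[OF ideal_I])
  interpret Q: ring ?Q
    by (rule ideal.quotient_is_ring[OF ideal_I])
  have closed: "proj p \<in> carrier ?Q" for p
    using ring_hom_closed[OF h, of p] by simp
  have zero: "proj 0 = \<zero>\<^bsub>?Q\<^esub>"
    using ring_hom_zero[OF h ring_free_star_algebra Q.ring_axioms] by simp
  have plus: "proj (p + q) = proj p \<oplus>\<^bsub>?Q\<^esub> proj q" for p q
    using ring_hom_add[OF h, of p q] by simp
  \<comment> \<open>Finite sums depend only on the carrier, the addition and the zero, which the two records share.\<close>
  have "finsum (star_quotient free_star_algebra I) (\<lambda>j. proj (f j)) S =
      finsum (free_star_algebra Quot I) (\<lambda>j. proj (f j)) S"
    by (simp add: finsum_def finprod_def star_quotient_def)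
  also have "\<dots> = proj (sum f S)"
    using assms
    by (induction S rule: finite_induct) (simp_all add: zero plus closed Q.finsum_insert)
  finally show ?thesis .
qed

lemma star_quotient_mat_act:
  "mat_act (star_quotient free_star_algebra I) M (\<lambda>j. proj (x j)) =
    (\<lambda>i. proj (mat_act free_star_algebra M x i))"
  by (rule ext)
    (simp add: mat_act_def star_quotient_smult star_quotient_finsum finsum_free_star_algebra)

lemma satisfies_relations_star_quotient:
  assumes "\<And>l r. (l, r) \<in> relations free_star_algebra s n1 n2 u x1 x2 \<Longrightarrow> l - r \<in> I"
  shows "satisfies_relations (star_quotient free_star_algebra I) s n1 n2 u
    (\<lambda>i. proj (x1 i)) (\<lambda>i. proj (x2 i))"
proof -
  have eq: "proj l = proj r" if "(l, r) \<in> relations free_star_algebra s n1 n2 u x1 x2" for l r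
    using that by (intro proj_eqI assms)
  have "l = r" if "(l, r) \<in> relations (star_quotient free_star_algebra I) s n1 n2 u
    (\<lambda>i. proj (x1 i)) (\<lambda>i. proj (x2 i))" for l r
  proof -
    from that have "\<exists>l' r'. l = proj l' \<and> r = proj r' \<and>
        (l', r') \<in> relations free_star_algebra s n1 n2 u x1 x2"
      unfolding relations_def
      by (simp add: star_quotient_ops star_quotient_star star_quotient_mat_act
          star_quotient_smult) blast
    then show ?thesis using eq by blast
  qed
  then show ?thesis
    unfolding satisfies_relations_def by (auto simp: star_quotient_ops)
qed

end

section \<open>Invariance of the relations\<close>

lemma star_ideal_star_ideal_generated:
  "star_ideal free_star_algebra (star_ideal_generated free_star_algebra S)"
proof -
  let ?F = "free_star_algebra :: ('a word \<Rightarrow>\<^sub>0 complex) star_algebra"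
  let ?C = "{I. star_ideal ?F I \<and> S \<subseteq> I}"
  interpret ring ?F by (rule ring_free_star_algebra)
  have "UNIV \<in> ?C"
    using oneideal by (simp add: star_ideal_def)
  then have "ideal (\<Inter>?C) ?F"
    by (intro i_Intersect) (auto simp: star_ideal_def)
  then show ?thesis
    unfolding star_ideal_generated_def star_ideal_def by auto
qed

lemma satisfies_relations_algebra_A:
  assumes "s \<noteq> t"
  shows "satisfies_relations (algebra_A s n1 n2 u) s n1 n2 u
    (mat_act (algebra_A s n1 n2 u) (J_quat t q1) (gen1 s n1 n2 u))
    (mat_act (algebra_A s n1 n2 u) (J_quat t q2) (gen2 s n1 n2 u))"
proof -
  let ?I = "relation_ideal s n1 n2 u"
  have I: "star_ideal free_star_algebra ?I"
    unfolding relation_ideal_def by (rule star_ideal_star_ideal_generated)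
  have rel: "l - r \<in> ?I"
    if "(l, r) \<in> relations free_star_algebra s n1 n2 u (gen \<circ> X1) (gen \<circ> X2)" for l r
    using that unfolding relation_ideal_def star_ideal_generated_def by blast
  have gens: "gen1 s n1 n2 u = (\<lambda>i. ?I +>\<^bsub>free_star_algebra\<^esub> (gen \<circ> X1) i)"
    "gen2 s n1 n2 u = (\<lambda>i. ?I +>\<^bsub>free_star_algebra\<^esub> (gen \<circ> X2) i)"
    by (simp_all add: fun_eq_iff gen1_def gen2_def)
  show ?thesis
    unfolding gens algebra_A_def star_quotient_mat_act[OF I]
    by (rule satisfies_relations_star_quotient[OF I],
        rule relations_mat_act_in_ideal[OF I rel J_vec_commute_J_quat[OF assms]
          J_vec_commute_J_quat[OF assms]])
qed

theorem mainTheorem4: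
  fixes n1 n2 :: "real ^ 3" and u :: "real ^ 3"
  assumes "norm n1 = 1" and "norm n2 = 1" and "orthogonal n1 n2"
    and "u \<in> sphere 0 1"
  shows "(\<forall>q1 \<in> unit_quats. \<forall>q2 \<in> unit_quats.
           satisfies_relations (algebra_A Plus n1 n2 u) Plus n1 n2 u
             (mat_act (algebra_A Plus n1 n2 u) (J_quat Minus q1) (gen1 Plus n1 n2 u))
             (mat_act (algebra_A Plus n1 n2 u) (J_quat Minus q2) (gen2 Plus n1 n2 u))) \<and>
         (\<forall>q1 \<in> unit_quats. \<forall>q2 \<in> unit_quats.
           satisfies_relations (algebra_A Minus n1 n2 u) Minus n1 n2 u
             (mat_act (algebra_A Minus n1 n2 u) (J_quat Plus q1) (gen1 Minus n1 n2 u))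
             (mat_act (algebra_A Minus n1 n2 u) (J_quat Plus q2) (gen2 Minus n1 n2 u)))"
  by (simp add: satisfies_relations_algebra_A)

end
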